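(* The closure of $\mathcal{Q}_G$ in $C(G)$ (with respect to the supremum norm) is exactly $\mathcal{F}_2$, i.e. $\overline{\mathcal{Q}_G}^{C(G)} = \mathcal{F}_2$.
   Context: $G := [0,1]$, and $C(G)$ is the Banach space of continuous real-valued functions on $G$ with the supremum norm $\|f\|_{C(G)} = \sup_{x\in G}|f(x)|$. $\mathcal{Q}$ is the set of real-valued univariate polynomials $p$ satisfying: (i) $p(x)\in[0,1]$ for all $x\in G$; (ii) $p(x)\le 0$ for all $x\le 0$; (iii$'$) $p(x)\le 0$ for all $x\ge 1$. $\mathcal{Q}_G := \{p|_G : p\in\mathcal{Q}\}\subseteq C(G)$. $\mathcal{F}_2$ is the set of all $f\in C(G)$ such that $f(0)=f(1)=0$ and $0\le f(x)\le 1$ for all $x\in G$. *)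

theory Defs
  imports "HOL-Analysis.Analysis" "HOL-Computational_Algebra.Polynomial"
begin

definition G :: "real set" where
  "G = {0..1}"

text \<open>The space \<open>C(G)\<close>. Its points are the continuous real functions on \<open>G\<close>, represented by
  functions \<open>real \<Rightarrow> real\<close> that take the fixed value \<^const>\<open>undefined\<close> outside \<open>G\<close> (so that
  equality is equality on \<open>G\<close>). The lemmas below record that the boundedness built into
  \<^const>\<open>cfunspace\<close> is automatic here and that its metric is the one induced by the supremum norm.\<close>

definition C_G :: "(real \<Rightarrow> real) metric" where
  "C_G = cfunspace (top_of_set G) euclidean_metric"

definition Q_polys :: "real poly set" where
  "Q_polys = {p. (\<forall>x\<in>G. poly p x \<in> {0..1}) \<and> (\<forall>x\<le>0. poly p x \<le> 0) \<and> (\<forall>x\<ge>1. poly p x \<le> 0)}"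

definition Q_G :: "(real \<Rightarrow> real) set" where
  "Q_G = (\<lambda>p. restrict (poly p) G) ` Q_polys"

definition F_2 :: "(real \<Rightarrow> real) set" where
  "F_2 = {f \<in> mspace C_G. f 0 = 0 \<and> f 1 = 0 \<and> (\<forall>x\<in>G. 0 \<le> f x \<and> f x \<le> 1)}"

lemma mspace_C_G: "mspace C_G = {f. continuous_on G f \<and> f \<in> extensional G}"
proof -
  have "Metric_space.mbounded UNIV dist (f ` G)" if "continuous_on G f" for f :: "real \<Rightarrow> real"
  proof -
    have "bounded (f ` G)"
      using that by (intro compact_imp_bounded compact_continuous_image) (auto simp: G_def)
    then show ?thesis
      by (simp add: mbounded_iff_bounded)
  qed
  then show ?thesis
    by (auto simp: C_G_def Metric_space.fspace_def[OF Met_TC.Metric_space_axioms])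
qed

lemma mdist_C_G:
  assumes "f \<in> mspace C_G" and "g \<in> mspace C_G"
  shows "mdist C_G f g = (SUP x\<in>G. \<bar>f x - g x\<bar>)"
proof -
  have "G \<noteq> {}"
    by (simp add: G_def)
  then show ?thesis
    using assms
    by (simp add: C_G_def cfunspace_def Metric_space.fdist_def[OF Met_TC.Metric_space_axioms] dist_real_def
        Metric_space.fspace_def[OF Met_TC.Metric_space_axioms])
qed

lemma Q_G_subset_C_G: "Q_G \<subseteq> mspace C_G"
  by (auto simp: Q_G_def mspace_C_G intro!: continuous_intros cong: continuous_on_cong)

end

theory Submission
  imports Defs
begin

text \<open>
  A limit of restrictions of polynomials in \<^const>\<open>Q_polys\<close> lies in \<^const>\<open>F_2\<close> because
  uniform convergence implies pointwise convergence and the conditions defining \<^const>\<open>F_2\<close> are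
  closed pointwise conditions. Every \<open>p\<close> in \<^const>\<open>Q_polys\<close> satisfies them: its value at an
  endpoint of \<open>G\<close> is both nonnegative and nonpositive.

  For the converse, the sign conditions on the whole line are built into the shape
  \<open>p(x) = x (1 - x) q(x)\<^sup>2\<close>, which is nonnegative on \<open>G\<close> and nonpositive off it whatever the
  polynomial \<open>q\<close> is. To approximate \<open>f\<close> in \<^const>\<open>F_2\<close> in this way one would like \<open>q\<close> to be close
  to \<open>sqrt (f(x) / (x (1 - x)))\<close>, which may be unbounded at the endpoints. Replacing \<open>f\<close> by
  its truncation \<open>max (f - e) 0\<close>, with \<open>0 < e \<le> 1\<close>, removes the singularity: by continuity \<open>f\<close> is
  smaller than \<open>e\<close> near \<open>0\<close> and \<open>1\<close>, so the truncation vanishes there. It also creates a margin: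
  the truncation is at most \<open>1 - e\<close>, so an approximation of it up to \<open>e\<close> stays at most \<open>1\<close> on
  \<open>G\<close>. The Weierstrass theorem then provides \<open>q\<close>.
\<close>

lemma poly_Weierstrass:
  fixes h :: "real \<Rightarrow> real"
  assumes "compact S" and "continuous_on S h" and "0 < e"
  obtains q :: "real poly" where "\<And>x. x \<in> S \<Longrightarrow> \<bar>h x - poly q x\<bar> < e"
proof -
  obtain g where g: "real_polynomial_function g" "\<And>x. x \<in> S \<Longrightarrow> \<bar>h x - g x\<bar> < e"
    using Stone_Weierstrass_real_polynomial_function[OF assms] by blast
  from g(1) obtain a n where "g = (\<lambda>x. \<Sum>i\<le>n. a i * x ^ i)"
    by (auto simp: real_polynomial_function_iff_sum)
  then have "poly (\<Sum>i\<le>n. monom (a i) i) x = g x" for x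
    by (simp add: poly_sum poly_monom)
  with g(2) that show thesis by metis
qed

text \<open>Squaring is Lipschitz on bounded sets, and \<open>h\<close> is bounded on the compact set \<open>S\<close>; hence a
  polynomial close to \<open>h\<close> has a square close to \<open>h\<^sup>2\<close>, and a weight in \<open>[0,1]\<close> does not enlarge
  the error.\<close>

lemma weighted_square_approximation:
  fixes h w :: "real \<Rightarrow> real"
  assumes "compact S" and "continuous_on S h" and "0 < e"
    and w: "\<And>x. x \<in> S \<Longrightarrow> 0 \<le> w x \<and> w x \<le> 1"
  obtains q :: "real poly" where "\<And>x. x \<in> S \<Longrightarrow> \<bar>w x * (h x)\<^sup>2 - w x * (poly q x)\<^sup>2\<bar> \<le> e"
proof -
  have "bounded (h ` S)"
    using assms compact_continuous_image compact_imp_bounded by blast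
  then obtain M where M: "0 < M" "\<And>x. x \<in> S \<Longrightarrow> \<bar>h x\<bar> \<le> M"
    by (force simp: bounded_pos)
  \<comment> \<open>With \<open>t \<le> 1\<close>, an error below \<open>t\<close> gives \<open>\<bar>h + q\<bar> \<le> 2 * M + 1\<close>, hence an error of at most
    \<open>t * (2 * M + 1)\<close> in the square.\<close>
  define t where "t = min 1 (e / (2 * M + 1))"
  have t: "0 < t" "t \<le> 1" "t \<le> e / (2 * M + 1)"
    using M(1) \<open>0 < e\<close> by (auto simp: t_def)
  have tM: "t * (2 * M + 1) \<le> e"
    using t(3) M(1) by (simp add: pos_le_divide_eq)
  obtain q :: "real poly" where q: "\<And>x. x \<in> S \<Longrightarrow> \<bar>h x - poly q x\<bar> < t"
    using poly_Weierstrass[OF assms(1,2) t(1)] by blast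
  have "\<bar>w x * (h x)\<^sup>2 - w x * (poly q x)\<^sup>2\<bar> \<le> e" if x: "x \<in> S" for x
  proof -
    have "\<bar>h x + poly q x\<bar> \<le> 2 * M + 1"
      using q[OF x] M(2)[OF x] t(2) by linarith
    then have "\<bar>h x - poly q x\<bar> * \<bar>h x + poly q x\<bar> \<le> t * (2 * M + 1)"
      using q[OF x] t(1) by (intro mult_mono) auto
    then have "w x * (\<bar>h x - poly q x\<bar> * \<bar>h x + poly q x\<bar>) \<le> 1 * e"
      using w[OF x] tM \<open>0 < e\<close> M(1) t(1) by (intro mult_mono) auto
    moreover have "w x * (h x)\<^sup>2 - w x * (poly q x)\<^sup>2 = w x * ((h x - poly q x) * (h x + poly q x))"
      by (simp add: power2_eq_square algebra_simps)
    ultimately show ?thesis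
      using w[OF x] by (simp add: abs_mult)
  qed
  with that show thesis by blast
qed

text \<open>The points where \<open>f\<close> is at least \<open>e\<close> form a compact subset of the open interval, on which the
  weight \<open>x (1 - x)\<close> attains a positive minimum if they exist at all.\<close>

lemma weight_bounded_below_where_large:
  fixes f :: "real \<Rightarrow> real"
  assumes f: "continuous_on G f" "f 0 = 0" "f 1 = 0" and "0 < e"
  obtains d :: real where "0 < d" and "\<And>x. x \<in> G \<Longrightarrow> e \<le> f x \<Longrightarrow> d \<le> x * (1 - x)"
proof -
  define K where "K = {x \<in> G. e \<le> f x}"
  have "K = G \<inter> f -` {e..}"
    by (auto simp: K_def)
  moreover have "closed (G \<inter> f -` {e..})"
    using f(1) by (intro continuous_closed_preimage) (auto simp: G_def)
  moreover have "compact G" by (simp add: G_def)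
  ultimately have "compact K"
    by (metis compact_Int_closed inf.absorb_iff2 inf_le1)
  have pos: "0 < x * (1 - x)" if "x \<in> K" for x
  proof -
    have "x \<noteq> 0" "x \<noteq> 1"
      using that f \<open>0 < e\<close> by (auto simp: K_def)
    then show ?thesis
      using that by (auto simp: K_def G_def)
  qed
  show thesis
  proof (cases "K = {}")
    case True
    with that[of 1] show thesis by (auto simp: K_def)
  next
    case False
    have "continuous_on K (\<lambda>x. x * (1 - x))"
      by (intro continuous_intros)
    then obtain z where "z \<in> K" "\<And>x. x \<in> K \<Longrightarrow> z * (1 - z) \<le> x * (1 - x)"
      using continuous_attains_inf[OF \<open>compact K\<close> False] by blast
    with that pos show thesis by (auto simp: K_def)
  qed
qed

lemma weighted_square_in_Q_polys:
  assumes "\<And>x. x \<in> G \<Longrightarrow> x * (1 - x) * (poly q x)\<^sup>2 \<le> 1"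
  shows "[:0, 1, -1:] * q\<^sup>2 \<in> Q_polys"
proof -
  have eq: "poly ([:0, 1, -1:] * q\<^sup>2) x = x * (1 - x) * (poly q x)\<^sup>2" for x
    by (simp add: algebra_simps)
  have "x * (1 - x) \<le> 0" if "x \<le> 0 \<or> 1 \<le> x" for x :: real
    using that by (auto simp: mult_le_0_iff)
  moreover have "0 \<le> x * (1 - x)" if "x \<in> G" for x
    using that by (simp add: G_def)
  ultimately show ?thesis
    using assms unfolding Q_polys_def mem_Collect_eq eq
    by (auto intro: mult_nonneg_nonneg mult_nonpos_nonneg)
qed

lemma Q_polys_approximate_F_2:
  assumes "f \<in> F_2" and "0 < e" and "e \<le> 1"
  obtains p where "p \<in> Q_polys" and "\<And>x. x \<in> G \<Longrightarrow> \<bar>f x - poly p x\<bar> \<le> 2 * e"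
proof -
  have f: "continuous_on G f" "f 0 = 0" "f 1 = 0" "\<And>x. x \<in> G \<Longrightarrow> 0 \<le> f x \<and> f x \<le> 1"
    using assms(1) by (auto simp: F_2_def mspace_C_G)
  obtain d where d: "0 < d" "\<And>x. x \<in> G \<Longrightarrow> e \<le> f x \<Longrightarrow> d \<le> x * (1 - x)"
    using weight_bounded_below_where_large[OF f(1-3) assms(2)] by blast
  \<comment> \<open>Where the truncation is nonzero the denominator is just \<open>x * (1 - x)\<close>. The
    constant \<open>d\<close> only keeps the denominator positive near the endpoints, where the numerator is
    zero.\<close>
  define h where "h = (\<lambda>x. sqrt (max (f x - e) 0 / max (x * (1 - x)) d))"
  have cont: "continuous_on G h"
    unfolding h_def using f(1) d(1) by (intro continuous_intros) auto
  have h: "x * (1 - x) * (h x)\<^sup>2 = max (f x - e) 0" if "x \<in> G" for x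
  proof (cases "e \<le> f x")
    case True
    have "d \<le> x * (1 - x)"
      by (rule d(2)[OF that True])
    then have "(h x)\<^sup>2 = (f x - e) / (x * (1 - x))" and "x * (1 - x) \<noteq> 0"
      using True d(1) by (simp_all only: h_def max_absorb1 real_sqrt_pow2) auto
    then show ?thesis
      using True by (simp only: nonzero_mult_div_cancel_left times_divide_eq_right) simp
  qed (simp add: h_def max_def)
  have w: "0 \<le> x * (1 - x) \<and> x * (1 - x) \<le> 1" if "x \<in> G" for x
    using that by (auto simp: G_def intro: mult_le_one)
  have "compact G" by (simp add: G_def)
  obtain q :: "real poly"
    where "\<And>x. x \<in> G \<Longrightarrow> \<bar>x * (1 - x) * (h x)\<^sup>2 - x * (1 - x) * (poly q x)\<^sup>2\<bar> \<le> e"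
    using weighted_square_approximation[where w = "\<lambda>x. x * (1 - x)",
        OF \<open>compact G\<close> cont assms(2) w] by blast
  then have q: "\<bar>max (f x - e) 0 - x * (1 - x) * (poly q x)\<^sup>2\<bar> \<le> e" if "x \<in> G" for x
    using h that by metis
  show thesis
  proof
    have "x * (1 - x) * (poly q x)\<^sup>2 \<le> 1" if "x \<in> G" for x
      using q[OF that] f(4)[OF that] assms(3) by linarith
    then show "[:0, 1, -1:] * q\<^sup>2 \<in> Q_polys"
      by (rule weighted_square_in_Q_polys)
    show "\<bar>f x - poly ([:0, 1, -1:] * q\<^sup>2) x\<bar> \<le> 2 * e" if "x \<in> G" for x
    proof -
      have "poly ([:0, 1, -1:] * q\<^sup>2) x = x * (1 - x) * (poly q x)\<^sup>2"
        by (simp add: algebra_simps)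
      with q[OF that] f(4)[OF that] show ?thesis by linarith
    qed
  qed
qed

lemma mdist_C_G_le_iff:
  assumes "f \<in> mspace C_G" and "g \<in> mspace C_G"
  shows "mdist C_G f g \<le> r \<longleftrightarrow> (\<forall>x\<in>G. \<bar>f x - g x\<bar> \<le> r)"
proof -
  have "continuous_on G (\<lambda>x. \<bar>f x - g x\<bar>)"
    using assms by (auto simp: mspace_C_G intro!: continuous_intros)
  then have "compact ((\<lambda>x. \<bar>f x - g x\<bar>) ` G)"
    by (intro compact_continuous_image) (simp_all add: G_def)
  then have "bdd_above ((\<lambda>x. \<bar>f x - g x\<bar>) ` G)"
    by (intro bounded_imp_bdd_above compact_imp_bounded)
  moreover have "G \<noteq> {}" by (simp add: G_def)
  ultimately show ?thesis
    using assms by (simp add: mdist_C_G cSUP_le_iff)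
qed

lemma in_closure_Q_G_iff:
  "f \<in> (mtopology_of C_G) closure_of Q_G \<longleftrightarrow>
    f \<in> mspace C_G \<and> (\<forall>r>0. \<exists>p\<in>Q_polys. \<forall>x\<in>G. \<bar>f x - poly p x\<bar> \<le> r)"
proof -
  interpret Metric_space "mspace C_G" "mdist C_G"
    by (rule Metric_space_mspace_mdist)
  have restr: "restrict (poly p) G \<in> mspace C_G" if "p \<in> Q_polys" for p
    using that Q_G_subset_C_G by (auto simp: Q_G_def)
  have "restrict (poly p) G \<in> mcball f r \<longleftrightarrow> (\<forall>x\<in>G. \<bar>f x - poly p x\<bar> \<le> r)"
    if "f \<in> mspace C_G" "p \<in> Q_polys" for p r
    using that restr by (simp add: in_mcball mdist_C_G_le_iff)
  then show ?thesis
    unfolding mtopology_of_def metric_closure_of_alt Q_G_def by auto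
qed

theorem theorem2p3:
  shows "(mtopology_of C_G) closure_of Q_G = F_2"
proof (intro equalityI subsetI)
  fix f assume "f \<in> (mtopology_of C_G) closure_of Q_G"
  then have f: "f \<in> mspace C_G"
    and approx: "\<And>r. 0 < r \<Longrightarrow> \<exists>p\<in>Q_polys. \<forall>x\<in>G. \<bar>f x - poly p x\<bar> \<le> r"
    by (auto simp: in_closure_Q_G_iff)
  have G01: "0 \<in> G" "1 \<in> G" by (auto simp: G_def)
  have range: "- r \<le> f x \<and> f x \<le> 1 + r" if x: "x \<in> G" and r: "0 < r" for x r
  proof -
    obtain p where "p \<in> Q_polys" "\<bar>f x - poly p x\<bar> \<le> r"
      using approx[OF r] x by blast
    moreover from this x have "0 \<le> poly p x" "poly p x \<le> 1"
      by (auto simp: Q_polys_def)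
    ultimately show ?thesis by linarith
  qed
  have endpoint: "f x \<le> r" if x: "x = 0 \<or> x = 1" and r: "0 < r" for x r
  proof -
    obtain p where "p \<in> Q_polys" "\<bar>f x - poly p x\<bar> \<le> r"
      using approx[OF r] x G01 by blast
    moreover from this x have "poly p x \<le> 0"
      by (auto simp: Q_polys_def)
    ultimately show ?thesis by linarith
  qed
  have nonneg: "0 \<le> f x" if "x \<in> G" for x
    by (rule field_le_epsilon) (use range[OF that] in force)
  moreover have "f x \<le> 1" if "x \<in> G" for x
    by (rule field_le_epsilon) (use range[OF that] in force)
  moreover have "f x = 0" if "x = 0 \<or> x = 1" for x
  proof (rule antisym)
    show "f x \<le> 0"
      by (rule field_le_epsilon) (use endpoint[OF that] in force)
    show "0 \<le> f x"
      using that G01 nonneg by blast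
  qed
  ultimately show "f \<in> F_2"
    using f by (simp add: F_2_def)
next
  fix f assume f: "f \<in> F_2"
  have "\<exists>p\<in>Q_polys. \<forall>x\<in>G. \<bar>f x - poly p x\<bar> \<le> r" if "0 < r" for r
  proof -
    define e where "e = min 1 (r / 2)"
    have "0 < e" "e \<le> 1" "2 * e \<le> r"
      using that by (auto simp: e_def)
    then show ?thesis
      using Q_polys_approximate_F_2[OF f, of e] by (metis order_trans)
  qed
  then show "f \<in> (mtopology_of C_G) closure_of Q_G"
    using f by (simp add: in_closure_Q_G_iff F_2_def)
qed

end
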